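(* Let $a_1,a_2,a_3>0$ and $y_1,y_2,y_3>0$ be real numbers such that \[ A(y_1,y_2,y_3)\ge A(a_1,a_2,a_3),\qquad H(a_1,a_2,a_3)\ge H(y_1,y_2,y_3),\qquad G(y_1,y_2,y_3)=G(a_1,a_2,a_3). \] Then \[ Q(\log y_1,\log y_2,\log y_3)\ \ge\ Q(\log a_1,\log a_2,\log a_3). \]
   Context: The arithmetic, harmonic, geometric and quadratic means are \[ A(y_1,y_2,y_3)=\frac{y_1+y_2+y_3}{3},\quad H(y_1,y_2,y_3)=\frac{3}{\frac1{y_1}+\frac1{y_2}+\frac1{y_3}},\quad G(y_1,y_2,y_3)=\sqrt[3]{y_1y_2y_3}, \] \[ Q(y_1,y_2,y_3)=\sqrt{\tfrac13\,(y_1^2+y_2^2+y_3^2)}, \] where $Q$ is defined for all real arguments. Note that the inequality between the harmonic means is in the reverse direction. $\log$ is the real natural logarithm. *)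

theory Defs
  imports Complex_Main
begin

definition arith_mean3 :: "real \<Rightarrow> real \<Rightarrow> real \<Rightarrow> real" where
  "arith_mean3 x y z = (x + y + z) / 3"

definition harm_mean3 :: "real \<Rightarrow> real \<Rightarrow> real \<Rightarrow> real" where
  "harm_mean3 x y z = 3 / (1 / x + 1 / y + 1 / z)"

definition geom_mean3 :: "real \<Rightarrow> real \<Rightarrow> real \<Rightarrow> real" where
  "geom_mean3 x y z = root 3 (x * y * z)"

definition quad_mean3 :: "real \<Rightarrow> real \<Rightarrow> real \<Rightarrow> real" where
  "quad_mean3 x y z = sqrt (1 / 3 * (x\<^sup>2 + y\<^sup>2 + z\<^sup>2))"

end

theory Submission
  imports Defs "HOL-Analysis.Analysis"
begin

text \<open>
  Put \<open>P\<^sub>x(t) = (t + x\<^sub>1)(t + x\<^sub>2)(t + x\<^sub>3)\<close>. Its coefficients are the elementary symmetric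
  functions of \<open>x\<close>, and at equal geometric means the hypotheses on the arithmetic and harmonic
  means compare the coefficients of \<open>t\<^sup>2\<close> and \<open>t\<close>. Hence \<open>P\<^sub>a(t) \<le> P\<^sub>y(t)\<close> for all \<open>t > 0\<close>, with
  equality at \<open>t = 0\<close>, and the conclusion is this inequality integrated on a logarithmic scale:
  \[ \int_0^\infty \frac{\ln P_y(t) - \ln P_a(t)}{t}\,dt
       = \frac12 \sum_i \bigl((\ln y_i)^2 - (\ln a_i)^2\bigr). \]

  The integral is evaluated through \<open>L(u) = \<integral>\<^sub>0\<^sup>u ln (1 + t) / t dt\<close>, which is the dilogarithm
  \<open>-Li\<^sub>2(-u)\<close>. As the products of the \<open>y\<^sub>i\<close> and of the \<open>a\<^sub>i\<close> agree, the integral up to \<open>T\<close> is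
  \<open>\<Sum>\<^sub>i (L(T / y\<^sub>i) - L(T / a\<^sub>i))\<close>. The inversion formula \<open>dilog_inversion\<close>,
  \<open>L(u) + L(1 / u) = 2 L(1) + (ln u)\<^sup>2 / 2\<close>, turns this into half the difference of the sums of
  squared logarithms plus terms \<open>L(a\<^sub>i / T) - L(y\<^sub>i / T)\<close>, which vanish as \<open>T\<close> grows
  because \<open>0 \<le> L(u) \<le> u\<close>. The argument does not depend on the number of variables and is carried out
  for finite families in \<open>sum_squared_ln_mono\<close>.
\<close>

definition dilog_integrand :: "real \<Rightarrow> real" where
  "dilog_integrand t = (if t = 0 then 1 else ln (1 + t) / t)"

definition dilog :: "real \<Rightarrow> real" where
  "dilog u = integral {0..u} dilog_integrand"

text \<open>The only critical point is \<open>0\<close>, where the quotient \<open>ln (1 + t) / t\<close> tends to the derivative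
  of \<open>ln\<close> at \<open>1\<close>.\<close>

lemma continuous_on_dilog_integrand: "continuous_on {0..} dilog_integrand"
proof -
  have "isCont dilog_integrand t" if "t \<ge> 0" for t
  proof (cases "t = 0")
    case True
    have "((\<lambda>t::real. ln (1 + t)) has_real_derivative 1) (at 0)"
      by (auto intro!: derivative_eq_intros)
    then have "((\<lambda>t::real. ln (1 + t) / t) \<longlongrightarrow> 1) (at 0)"
      by (simp add: has_field_derivative_iff)
    moreover have "\<forall>\<^sub>F t in at 0. ln (1 + t) / t = dilog_integrand t"
      by (auto simp: eventually_at_filter dilog_integrand_def)
    ultimately have "(dilog_integrand \<longlongrightarrow> 1) (at 0)"
      by (rule Lim_transform_eventually)
    then show ?thesis
      using True by (simp add: isCont_def dilog_integrand_def)
  next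
    case False
    have "isCont (\<lambda>t. ln (1 + t) / t) t"
      using that False by (intro continuous_intros) auto
    moreover have "\<forall>\<^sub>F s in nhds t. dilog_integrand s = ln (1 + s) / s"
      using t1_space_nhds[OF False] by eventually_elim (simp add: dilog_integrand_def)
    ultimately show ?thesis
      by (simp add: isCont_cong)
  qed
  then show ?thesis
    by (intro continuous_at_imp_continuous_on) auto
qed

lemma dilog_integrand_integrable: "dilog_integrand integrable_on {0..u}"
  by (intro integrable_continuous_interval continuous_on_subset[OF continuous_on_dilog_integrand]) auto

lemma dilog_integrand_bounds:
  assumes "t \<ge> 0"
  shows "0 \<le> dilog_integrand t" "dilog_integrand t \<le> 1"
  using assms ln_add_one_self_le_self[of t]
  by (auto simp: dilog_integrand_def)

lemma dilog_nonneg: "dilog u \<ge> 0"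
  unfolding dilog_def by (intro integral_nonneg dilog_integrand_integrable) (auto intro: dilog_integrand_bounds)

lemma dilog_le_self:
  assumes "u \<ge> 0"
  shows "dilog u \<le> u"
proof -
  have "integral {0..u} dilog_integrand \<le> integral {0..u} (\<lambda>_. 1)"
    by (intro integral_le dilog_integrand_integrable) (auto intro: dilog_integrand_bounds)
  then show ?thesis
    using assms by (simp add: dilog_def)
qed

lemma continuous_on_dilog: "continuous_on {0..b} dilog"
  unfolding dilog_def by (intro indefinite_integral_continuous_1 dilog_integrand_integrable)

lemma DERIV_dilog:
  assumes "u > 0"
  shows "(dilog has_real_derivative ln (1 + u) / u) (at u)"
proof -
  have "(dilog has_real_derivative dilog_integrand u) (at u within {0..u + 1})"
    unfolding dilog_def using assms
    by (intro integral_has_real_derivative continuous_on_subset[OF continuous_on_dilog_integrand]) auto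
  moreover have "at u within {0..u + 1} = at u"
    using assms by (intro at_within_interior) auto
  ultimately show ?thesis
    using assms by (simp add: dilog_integrand_def)
qed

lemma DERIV_dilog_scaled:
  assumes "c > 0" "t > 0"
  shows "((\<lambda>t. dilog (t / c)) has_real_derivative ln (1 + t / c) / t) (at t)"
proof -
  have "((\<lambda>t. dilog (t / c)) has_real_derivative ln (1 + t / c) / (t / c) * (1 / c)) (at t)"
    using assms by (intro DERIV_chain2[OF DERIV_dilog]) (auto intro!: derivative_eq_intros)
  then show ?thesis
    using assms by simp
qed

text \<open>The derivatives of \<open>dilog u\<close> and \<open>dilog (1 / u)\<close> are \<open>ln (1 + u) / u\<close> and
  \<open>- ln (1 + 1 / u) / u\<close>; they add up to \<open>ln u / u\<close>, the derivative of \<open>(ln u)\<^sup>2 / 2\<close>.\<close>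

lemma dilog_inversion:
  assumes "u > 0"
  shows "dilog u + dilog (1 / u) = 2 * dilog 1 + (ln u)\<^sup>2 / 2"
proof -
  define h where "h v = dilog v + dilog (1 / v) - (ln v)\<^sup>2 / 2" for v
  have "(h has_real_derivative 0) (at v within {0<..})" if "v \<in> {0<..}" for v
  proof -
    have v: "v > 0" using that by simp
    have "((\<lambda>v. dilog (1 / v)) has_real_derivative ln (1 + 1 / v) / (1 / v) * (- 1 / v\<^sup>2)) (at v)"
      using v by (intro DERIV_chain2[OF DERIV_dilog])
        (auto intro!: derivative_eq_intros simp: power2_eq_square)
    moreover have "((\<lambda>v. (ln v)\<^sup>2 / 2) has_real_derivative ln v / v) (at v)"
      using v by (auto intro!: derivative_eq_intros)
    ultimately have "(h has_real_derivative
        ln (1 + v) / v + ln (1 + 1 / v) / (1 / v) * (- 1 / v\<^sup>2) - ln v / v) (at v)"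
      unfolding h_def using v by (intro DERIV_diff DERIV_add DERIV_dilog) auto
    moreover have "ln (1 + 1 / v) = ln (1 + v) - ln v"
      using v ln_div[of "1 + v" v] by (simp add: add_divide_distrib add.commute)
    then have "ln (1 + v) / v + ln (1 + 1 / v) / (1 / v) * (- 1 / v\<^sup>2) - ln v / v = 0"
      using v by (simp only:) (simp add: field_simps power2_eq_square)
    ultimately have "(h has_real_derivative 0) (at v)"
      by (simp only:)
    then show ?thesis
      by (rule has_field_derivative_at_within)
  qed
  then have "\<exists>c. \<forall>v\<in>{0<..}. h v = c"
    by (intro has_field_derivative_zero_constant) auto
  then have "h u = h 1"
    using assms by fastforce
  then show ?thesis
    by (simp add: h_def)
qed

text \<open>This is the sum of squared logarithms inequality, with the comparison of the elementary
  symmetric functions weakened to a comparison of the polynomials that they are the coefficients of.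
  The integral up to \<open>T\<close> is \<open>S T\<close>: its integrand is nonnegative by that comparison, and dilogarithm
  inversion evaluates it up to an error of order \<open>1 / T\<close>.\<close>

lemma sum_squared_ln_mono:
  fixes a y :: "'i \<Rightarrow> real"
  assumes fin: "finite I"
    and a: "\<And>i. i \<in> I \<Longrightarrow> a i > 0" and y: "\<And>i. i \<in> I \<Longrightarrow> y i > 0"
    and poly_le: "\<And>t. t > 0 \<Longrightarrow> (\<Prod>i\<in>I. t + a i) \<le> (\<Prod>i\<in>I. t + y i)"
    and prod_eq: "(\<Prod>i\<in>I. a i) = (\<Prod>i\<in>I. y i)"
  shows "(\<Sum>i\<in>I. (ln (a i))\<^sup>2) \<le> (\<Sum>i\<in>I. (ln (y i))\<^sup>2)"
proof -
  have sum_ln: "(\<Sum>i\<in>I. ln (c i)) = ln (\<Prod>i\<in>I. c i)"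
    if "\<And>i. i \<in> I \<Longrightarrow> c i > 0" for c :: "'i \<Rightarrow> real"
  proof (rule ln_prod[symmetric, OF fin])
    show "c i \<noteq> 0" if "i \<in> I" for i
      using \<open>\<And>i. i \<in> I \<Longrightarrow> c i > 0\<close>[OF that] by simp
  qed
  have sum_ln_eq: "(\<Sum>i\<in>I. ln (a i)) = (\<Sum>i\<in>I. ln (y i))"
    using sum_ln[OF a] sum_ln[OF y] by (simp add: prod_eq)
  define S where "S T = (\<Sum>i\<in>I. dilog (T / y i) - dilog (T / a i))" for T
  have S_nonneg: "S T \<ge> 0" if "T > 0" for T
  proof -
    have "S 0 \<le> S T"
    proof (rule DERIV_nonneg_imp_increasing_open[where f = S])
      fix t assume "0 < t" "t < T"
      then have t: "t > 0" by simp
      have "(S has_real_derivative (\<Sum>i\<in>I. ln (1 + t / y i) / t - ln (1 + t / a i) / t)) (at t)"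
        unfolding S_def using a y t by (intro DERIV_sum DERIV_diff DERIV_dilog_scaled) auto
      moreover have "(\<Sum>i\<in>I. ln (1 + t / y i) / t - ln (1 + t / a i) / t) \<ge> 0"
      proof -
        have ln_split: "ln (1 + t / c) = ln (t + c) - ln c" if "c > 0" for c
          using that t ln_div[of "t + c" c] by (simp add: add_divide_distrib add.commute)
        have "(\<Sum>i\<in>I. ln (t + a i)) = ln (\<Prod>i\<in>I. t + a i)"
          using a t by (intro sum_ln) (auto intro: add_pos_pos)
        also have "\<dots> \<le> ln (\<Prod>i\<in>I. t + y i)"
          using poly_le[OF t] a t by (intro ln_mono prod_pos) (auto intro: add_pos_pos)
        also have "\<dots> = (\<Sum>i\<in>I. ln (t + y i))"
          using y t by (intro sum_ln[symmetric]) (auto intro: add_pos_pos)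
        finally have "(\<Sum>i\<in>I. ln (1 + t / a i)) \<le> (\<Sum>i\<in>I. ln (1 + t / y i))"
          using sum_ln_eq a y by (simp add: ln_split sum_subtractf)
        then show ?thesis
          using t by (simp add: sum_subtractf divide_right_mono flip: sum_divide_distrib)
      qed
      ultimately show "\<exists>D. (S has_real_derivative D) (at t) \<and> D \<ge> 0"
        by blast
    next
      have "continuous_on {0..T} (\<lambda>t. dilog (t / c))" if "c > 0" for c
        using that by (intro continuous_on_compose2[OF continuous_on_dilog[of "T / c"]])
          (auto intro!: continuous_intros simp: divide_right_mono)
      then show "continuous_on {0..T} S"
        unfolding S_def using a y by (intro continuous_on_sum continuous_on_diff) auto
    qed (use that in simp)
    then show ?thesis
      by (simp add: S_def)
  qed
  define D where "D = (\<Sum>i\<in>I. (ln (y i))\<^sup>2) - (\<Sum>i\<in>I. (ln (a i))\<^sup>2)"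
  have D_ge: "- D \<le> 2 * (\<Sum>i\<in>I. a i) * e" if "e > 0" for e
  proof -
    \<comment> \<open>With \<open>T = 1 / e\<close>, inversion exchanges the large argument \<open>T / c\<close> for the small one \<open>e * c\<close>.\<close>
    have inv: "dilog (1 / (e * c)) = 2 * dilog 1 + (ln e)\<^sup>2 / 2 + ln e * ln c + (ln c)\<^sup>2 / 2 - dilog (e * c)"
      if "c > 0" for c
      using dilog_inversion[of "e * c"] that \<open>e > 0\<close>
      by (simp add: ln_mult power2_eq_square algebra_simps add_divide_distrib)
    have "S (1 / e) = (\<Sum>i\<in>I. (ln e * ln (y i) - ln e * ln (a i)) + ((ln (y i))\<^sup>2 / 2 - (ln (a i))\<^sup>2 / 2)
        + (dilog (e * a i) - dilog (e * y i)))"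
      unfolding S_def using a y by (intro sum.cong) (auto simp: inv)
    also have "\<dots> = D / 2 + (\<Sum>i\<in>I. dilog (e * a i) - dilog (e * y i))"
      using sum_ln_eq
      by (simp add: sum.distrib sum_subtractf D_def diff_divide_distrib
          flip: sum_distrib_left sum_divide_distrib)
    also have "(\<Sum>i\<in>I. dilog (e * a i) - dilog (e * y i)) \<le> (\<Sum>i\<in>I. e * a i)"
      using a that by (intro sum_mono) (smt (verit) dilog_nonneg dilog_le_self mult_pos_pos)
    finally show ?thesis
      using S_nonneg[of "1 / e"] that by (simp add: mult_ac flip: sum_distrib_left)
  qed
  have "((\<lambda>e. 2 * (\<Sum>i\<in>I. a i) * e) \<longlongrightarrow> 2 * (\<Sum>i\<in>I. a i) * 0) (at_right 0)"
    by (intro tendsto_intros)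
  then have "- D \<le> 2 * (\<Sum>i\<in>I. a i) * 0"
    by (rule tendsto_lowerbound) (use D_ge in \<open>auto simp: eventually_at_filter\<close>)
  then show ?thesis
    by (simp add: D_def)
qed

theorem theorem5:
  fixes a1 a2 a3 y1 y2 y3 :: real
  assumes "a1 > 0" and "a2 > 0" and "a3 > 0"
    and "y1 > 0" and "y2 > 0" and "y3 > 0"
    and "arith_mean3 y1 y2 y3 \<ge> arith_mean3 a1 a2 a3"
    and "harm_mean3 a1 a2 a3 \<ge> harm_mean3 y1 y2 y3"
    and "geom_mean3 y1 y2 y3 = geom_mean3 a1 a2 a3"
  shows "quad_mean3 (ln y1) (ln y2) (ln y3) \<ge> quad_mean3 (ln a1) (ln a2) (ln a3)"
proof -
  note pos = assms(1-6)
  have e1: "a1 + a2 + a3 \<le> y1 + y2 + y3"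
    using assms(7) by (simp add: arith_mean3_def)
  have e3: "a1 * a2 * a3 = y1 * y2 * y3"
    using assms(9) by (simp add: geom_mean3_def)
  have e2: "a1 * a2 + a2 * a3 + a3 * a1 \<le> y1 * y2 + y2 * y3 + y3 * y1"
  proof -
    have sum_inverse: "(u * v * w) * (1 / u + 1 / v + 1 / w) = u * v + v * w + w * u"
      if "u > 0" "v > 0" "w > 0" for u v w :: real
      using that by (simp add: field_simps)
    have reciprocal_antimono: "s \<le> r" if "3 / r \<le> 3 / s" "r > 0" "s > 0" for r s :: real
      using that by (simp add: divide_simps)
    have "1 / a1 + 1 / a2 + 1 / a3 \<le> 1 / y1 + 1 / y2 + 1 / y3"
      by (rule reciprocal_antimono[OF assms(8)[unfolded harm_mean3_def]])
        (use pos in \<open>auto intro!: add_pos_pos\<close>)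
    then have "(a1 * a2 * a3) * (1 / a1 + 1 / a2 + 1 / a3) \<le> (a1 * a2 * a3) * (1 / y1 + 1 / y2 + 1 / y3)"
      using pos by (intro mult_left_mono) auto
    then show ?thesis
      unfolding sum_inverse[OF pos(1-3)] unfolding e3 sum_inverse[OF pos(4-6)] .
  qed
  define a where "a = (!) [a1, a2, a3]"
  define y where "y = (!) [y1, y2, y3]"
  have I: "{..<3::nat} = {0, 1, 2}" by auto
  have "(\<Sum>i<3. (ln (a i))\<^sup>2) \<le> (\<Sum>i<3. (ln (y i))\<^sup>2)"
  proof (rule sum_squared_ln_mono)
    fix t :: real assume t: "t > 0"
    have "(t + a1) * ((t + a2) * (t + a3))
        = t^3 + (a1 + a2 + a3) * t\<^sup>2 + (a1 * a2 + a2 * a3 + a3 * a1) * t + a1 * a2 * a3"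
      by (simp add: algebra_simps power2_eq_square power3_eq_cube)
    also have "\<dots> \<le> t^3 + (y1 + y2 + y3) * t\<^sup>2 + (y1 * y2 + y2 * y3 + y3 * y1) * t + y1 * y2 * y3"
      using mult_right_mono[OF e1 zero_le_power2[of t]] mult_right_mono[OF e2 less_imp_le[OF t]] e3
      by linarith
    also have "\<dots> = (t + y1) * ((t + y2) * (t + y3))"
      by (simp add: algebra_simps power2_eq_square power3_eq_cube)
    finally show "(\<Prod>i<3. t + a i) \<le> (\<Prod>i<3. t + y i)"
      by (simp add: I a_def y_def)
  qed (use pos e3 in \<open>auto simp: I a_def y_def mult.assoc\<close>)
  then show ?thesis
    by (simp add: quad_mean3_def I a_def y_def add.assoc)
qed

end
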